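(* Let $\mathcal{M}$ and $\mathcal{M}^{\rm r}$ be the probability measures, on the space of paths $\Gamma$, of an original process and of a reference process. Let $\mathcal{M}^{\rm r}=\mathcal{M}^{\rm r}_{\rm AC}+\mathcal{M}^{\rm r}_{\rm S}$ be the Lebesgue decomposition of $\mathcal{M}^{\rm r}$ with respect to $\mathcal{M}$, let the entropy production $\sigma$ be given by $e^{-\sigma}=d\mathcal{M}^{\rm r}_{\rm AC}/d\mathcal{M}$, and let $\lambda_{\rm S}=\int\mathcal{M}^{\rm r}_{\rm S}[d\Gamma]$ be the probability of the singular part. Then for an arbitrary functional $\mathcal{F}[\Gamma]$ of a path $\Gamma$, $$\langle \mathcal{F}e^{-\sigma}\rangle=\langle\mathcal{F}\rangle^{\rm r}-\langle\mathcal{F}\rangle^{\rm r}_{\rm S}.$$ Setting $\mathcal{F}$ to unity, $$\langle e^{-\sigma}\rangle=1-\lambda_{\rm S},$$ and consequently, by Jensen's inequality, $$\langle\sigma\rangle\ge-\ln(1-\lambda_{\rm S}).$$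
   Context: The Lebesgue decomposition is the unique decomposition into measures with $\mathcal{M}^{\rm r}_{\rm AC}$ absolutely continuous with respect to $\mathcal{M}$ (the "ordinary irreversible" part) and $\mathcal{M}^{\rm r}_{\rm S}$ singular with respect to $\mathcal{M}$ (the "absolutely irreversible" part). $d\mathcal{M}^{\rm r}_{\rm AC}/d\mathcal{M}$ is the Radon–Nikodym derivative, a nonnegative function; where it vanishes, $\sigma$ is $+\infty$. The notations $\langle\cdot\rangle$, $\langle\cdot\rangle^{\rm r}$ and $\langle\cdot\rangle^{\rm r}_{\rm S}$ denote integration over paths against $\mathcal{M}$, $\mathcal{M}^{\rm r}$ and $\mathcal{M}^{\rm r}_{\rm S}$, respectively (the last measure is not normalized). *)

theory Defs
  imports "HOL-Probability.Probability_Measure"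
begin

(* Exponential and logarithm on the extended reals, so that sigma = +infinity exactly where
   e^(-sigma) = 0, and -ln(1 - lambda_S) = +infinity when lambda_S = 1. *)

definition exp_ereal :: "ereal \<Rightarrow> ereal" where
  "exp_ereal x = (case x of ereal r \<Rightarrow> ereal (exp r) | PInfty \<Rightarrow> \<infinity> | MInfty \<Rightarrow> 0)"

(* Arguments below 0 are mapped to -infinity; only arguments in [0, infinity] are meaningful. *)
definition ln_ereal :: "ereal \<Rightarrow> ereal" where
  "ln_ereal x =
     (case x of ereal r \<Rightarrow> (if r > 0 then ereal (ln r) else - \<infinity>) | PInfty \<Rightarrow> \<infinity> | MInfty \<Rightarrow> - \<infinity>)"

lemma exp_ereal_ln_ereal: "x \<ge> 0 \<Longrightarrow> exp_ereal (ln_ereal x) = x"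
  by (cases x) (auto simp: exp_ereal_def ln_ereal_def zero_ereal_def)

lemma ln_ereal_exp_ereal: "ln_ereal (exp_ereal x) = x"
  by (cases x) (auto simp: exp_ereal_def ln_ereal_def zero_ereal_def)

(* The bracket <f>: the integral of an extended-real function as the difference of the integrals
   of its positive and negative parts. It is meaningful when at most one of them is infinite,
   which is what has_average records. The Bochner integral would return 0 when <sigma> = +infinity. *)

definition average :: "'a measure \<Rightarrow> ('a \<Rightarrow> ereal) \<Rightarrow> ereal" where
  "average M f =
     enn2ereal (\<integral>\<^sup>+ x. e2ennreal (f x) \<partial>M) - enn2ereal (\<integral>\<^sup>+ x. e2ennreal (- f x) \<partial>M)"

definition has_average :: "'a measure \<Rightarrow> ('a \<Rightarrow> ereal) \<Rightarrow> bool" where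
  "has_average M f \<longleftrightarrow> f \<in> borel_measurable M \<and>
     ((\<integral>\<^sup>+ x. e2ennreal (f x) \<partial>M) < \<infinity> \<or> (\<integral>\<^sup>+ x. e2ennreal (- f x) \<partial>M) < \<infinity>)"

lemma average_eq_lebesgue_integral:
  fixes f :: "'a \<Rightarrow> real"
  assumes f: "integrable M f"
  shows "has_average M (\<lambda>x. ereal (f x))"
    and "average M (\<lambda>x. ereal (f x)) = ereal (integral\<^sup>L M f)"
proof -
  have pos: "(\<integral>\<^sup>+ x. ennreal (f x) \<partial>M) < \<infinity>" and neg: "(\<integral>\<^sup>+ x. ennreal (- f x) \<partial>M) < \<infinity>"
    using f by (auto simp: real_integrable_def less_top)
  show "has_average M (\<lambda>x. ereal (f x))"
    using f pos by (auto simp: has_average_def ennreal.abs_eq)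
  show "average M (\<lambda>x. ereal (f x)) = ereal (integral\<^sup>L M f)"
    using pos neg
    by (cases "\<integral>\<^sup>+ x. ennreal (f x) \<partial>M"; cases "\<integral>\<^sup>+ x. ennreal (- f x) \<partial>M")
       (auto simp: average_def real_lebesgue_integral_def[OF f] enn2ereal_ennreal)
qed

definition mutually_singular :: "'a measure \<Rightarrow> 'a measure \<Rightarrow> bool" where
  "mutually_singular M N \<longleftrightarrow>
     (\<exists>A \<in> sets M \<inter> sets N. emeasure M A = 0 \<and> emeasure N (space N - A) = 0)"

definition lebesgue_decomposition ::
  "'a measure \<Rightarrow> 'a measure \<Rightarrow> 'a measure \<Rightarrow> 'a measure \<Rightarrow> bool" where
  "lebesgue_decomposition M N N_AC N_S \<longleftrightarrow>
     sets N = sets M \<and> sets N_AC = sets M \<and> sets N_S = sets M \<and>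
     (\<forall>A \<in> sets M. emeasure N A = emeasure N_AC A + emeasure N_S A) \<and>
     absolutely_continuous M N_AC \<and> mutually_singular M N_S"

end

theory Submission
  imports Defs
begin

(* The integral identity is the Radon-Nikodym change of measure applied separately to the positive
   and negative parts of the functional.  For the inequality, -sigma <= exp (- sigma) makes the
   negative part of sigma integrable; then either <sigma> = +infinity, or sigma is integrable and
   Jensen gives exp (- <sigma>) <= 1 - lambda_S, which also excludes lambda_S = 1. *)

text \<open>The Lebesgue decomposition is given set by set. Induction over nonnegative measurable
  functions lifts it from indicators to integrals; in the limit step both integral sequences
  increase, so their suprema add.\<close>

lemma nn_integral_measure_add:
  assumes sets: "sets N = sets L" "sets K = sets L"
    and add: "\<And>A. A \<in> sets L \<Longrightarrow> emeasure L A = emeasure N A + emeasure K A"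
    and f: "f \<in> borel_measurable L"
  shows "(\<integral>\<^sup>+ x. f x \<partial>L) = (\<integral>\<^sup>+ x. f x \<partial>N) + (\<integral>\<^sup>+ x. f x \<partial>K)"
  using f
proof (induction f rule: borel_measurable_induct)
  note [measurable_cong] = sets
  note space = sets_eq_imp_space_eq[OF sets(1)] sets_eq_imp_space_eq[OF sets(2)]
  {
    case (cong f g)
    then show ?case
      by (simp add: space cong: nn_integral_cong_simp)
  next
    case (set A)
    then show ?case
      by (simp add: add sets)
  next
    case (mult u c)
    have [measurable]: "u \<in> borel_measurable L" by fact
    show ?case
      by (simp add: nn_integral_cmult mult distrib_left)
  next
    case (add u v)
    have [measurable]: "u \<in> borel_measurable L" "v \<in> borel_measurable L" by fact+
    show ?case
      by (simp add: nn_integral_add add ac_simps)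
  next
    case (seq U)
    have [measurable]: "U i \<in> borel_measurable L" for i by fact
    have mono: "incseq (\<lambda>i. \<integral>\<^sup>+ x. U i x \<partial>P)" for P
      using \<open>incseq U\<close> by (auto simp: incseq_def le_fun_def intro!: nn_integral_mono)
    show ?case
      by (simp add: image_image nn_integral_monotone_convergence_SUP \<open>incseq U\<close> seq
          ennreal_SUP_add mono)
  }
qed

text \<open>\<open>e2ennreal\<close> truncates negative values to 0, and a nonnegative factor cannot
  make a negative value positive. Hence multiplying a functional by the density multiplies its
  positive and negative parts separately.\<close>

lemma e2ennreal_mult_nonneg:
  assumes "0 \<le> b"
  shows "e2ennreal (a * b) = e2ennreal a * e2ennreal b"
proof (cases "0 \<le> a")
  case True
  then show ?thesis
    using assms by (metis e2ennreal_enn2ereal enn2ereal_e2ennreal times_ennreal.rep_eq)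
next
  case False
  then have "a * b \<le> 0"
    using assms by (simp add: ereal_mult_le_0_iff)
  with False show ?thesis
    by (simp add: e2ennreal_neg)
qed

lemma exp_ereal_nonneg: "0 \<le> exp_ereal x"
  by (cases x) (auto simp: exp_ereal_def zero_ereal_def)

lemma e2ennreal_le_exp_ereal: "e2ennreal x \<le> e2ennreal (exp_ereal x)"
proof (rule e2ennreal_mono, cases x)
  case (real r)
  have "r \<le> exp r"
    using exp_ge_add_one_self[of r] by linarith
  with real show "x \<le> exp_ereal x"
    by (simp add: exp_ereal_def)
qed (auto simp: exp_ereal_def)

theorem mainTheorem1:
  fixes M Mr Mr_AC Mr_S :: "'a measure"
    and \<sigma> :: "'a \<Rightarrow> ereal"
    and lambda_S :: real
  assumes "prob_space M"
    and "prob_space Mr"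
    and "sets Mr = sets M"
    and "lebesgue_decomposition M Mr Mr_AC Mr_S"
    and "\<sigma> \<in> borel_measurable M"
    and "AE x in M. exp_ereal (- \<sigma> x) = enn2ereal (RN_deriv M Mr_AC x)"
    and "lambda_S = measure Mr_S (space Mr_S)"
  shows "(\<forall>F :: 'a \<Rightarrow> ereal. has_average Mr F \<and> \<bar>average Mr_S F\<bar> \<noteq> \<infinity> \<longrightarrow>
            has_average M (\<lambda>x. F x * exp_ereal (- \<sigma> x)) \<and>
            average M (\<lambda>x. F x * exp_ereal (- \<sigma> x)) = average Mr F - average Mr_S F)
       \<and> average M (\<lambda>x. exp_ereal (- \<sigma> x)) = ereal (1 - lambda_S)
       \<and> has_average M \<sigma>
       \<and> average M \<sigma> \<ge> - ln_ereal (ereal (1 - lambda_S))"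
proof -
  interpret M: prob_space M by fact
  interpret Mr: prob_space Mr by fact
  note sets_Mr = assms(3)
  have sets_AC: "sets Mr_AC = sets M" and sets_S: "sets Mr_S = sets M"
    and add: "\<And>A. A \<in> sets M \<Longrightarrow> emeasure Mr A = emeasure Mr_AC A + emeasure Mr_S A"
    and ac: "absolutely_continuous M Mr_AC"
    using assms(4) by (auto simp: lebesgue_decomposition_def)
  note [measurable_cong] = sets_Mr
  note [measurable] = assms(5)
  \<comment> \<open>The density as an \<open>ennreal\<close> function built from \<sigma> itself; it
    agrees with \<open>RN_deriv\<close> only almost everywhere, which suffices under the
    integral.\<close>
  define g where "g x = e2ennreal (exp_ereal (- \<sigma> x))" for x
  have exp_ereal_measurable [measurable]: "exp_ereal \<in> borel_measurable borel"
  proof -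
    have "exp_ereal =
        (\<lambda>x. if x = \<infinity> then \<infinity> else if x = -\<infinity> then 0 else ereal (exp (real_of_ereal x)))"
      by (auto simp: fun_eq_iff exp_ereal_def split: ereal.splits)
    moreover have "\<dots> \<in> borel_measurable borel"
      by measurable
    ultimately show ?thesis by simp
  qed
  have g_RN: "AE x in M. g x = RN_deriv M Mr_AC x"
    using assms(6) by eventually_elim (simp add: g_def)
  have AC_eq: "(\<integral>\<^sup>+ x. h x \<partial>Mr_AC) = (\<integral>\<^sup>+ x. h x * g x \<partial>M)"
    if [measurable]: "h \<in> borel_measurable M" for h
  proof -
    have "(\<integral>\<^sup>+ x. h x \<partial>Mr_AC) = (\<integral>\<^sup>+ x. RN_deriv M Mr_AC x * h x \<partial>M)"
      by (rule M.RN_deriv_nn_integral[OF ac sets_AC that])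
    also have "\<dots> = (\<integral>\<^sup>+ x. h x * g x \<partial>M)"
      using g_RN by (intro nn_integral_cong_AE) (auto simp: mult.commute)
    finally show ?thesis .
  qed
  \<comment> \<open>The source of both equalities: the signed identity takes \<open>h\<close> to be
    each part of the functional, the normalization takes \<open>h\<close> to be 1. As everything is
    nonnegative, infinite values need no care here.\<close>
  have Mr_split: "(\<integral>\<^sup>+ x. h x \<partial>Mr) = (\<integral>\<^sup>+ x. h x * g x \<partial>M) + (\<integral>\<^sup>+ x. h x \<partial>Mr_S)"
    if [measurable]: "h \<in> borel_measurable M" for h
  proof -
    have "(\<integral>\<^sup>+ x. h x \<partial>Mr) = (\<integral>\<^sup>+ x. h x \<partial>Mr_AC) + (\<integral>\<^sup>+ x. h x \<partial>Mr_S)"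
      by (rule nn_integral_measure_add) (simp_all add: sets_Mr sets_AC sets_S add)
    then show ?thesis by (simp add: AC_eq)
  qed

  have functional: "has_average M (\<lambda>x. F x * exp_ereal (- \<sigma> x)) \<and>
      average M (\<lambda>x. F x * exp_ereal (- \<sigma> x)) = average Mr F - average Mr_S F"
    if F: "has_average Mr F" and fin: "\<bar>average Mr_S F\<bar> \<noteq> \<infinity>" for F
  proof -
    have [measurable]: "F \<in> borel_measurable M"
      using F by (simp add: has_average_def measurable_cong_sets[OF sets_Mr refl])
    define p where "p = (\<integral>\<^sup>+ x. e2ennreal (F x) * g x \<partial>M)"
    define n where "n = (\<integral>\<^sup>+ x. e2ennreal (- F x) * g x \<partial>M)"
    define pS where "pS = (\<integral>\<^sup>+ x. e2ennreal (F x) \<partial>Mr_S)"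
    define nS where "nS = (\<integral>\<^sup>+ x. e2ennreal (- F x) \<partial>Mr_S)"
    have pos: "(\<integral>\<^sup>+ x. e2ennreal (F x) \<partial>Mr) = p + pS"
      and neg: "(\<integral>\<^sup>+ x. e2ennreal (- F x) \<partial>Mr) = n + nS"
      unfolding p_def n_def pS_def nS_def by (simp_all add: Mr_split)
    have prod: "e2ennreal (F x * exp_ereal (- \<sigma> x)) = e2ennreal (F x) * g x"
      "e2ennreal (- (F x * exp_ereal (- \<sigma> x))) = e2ennreal (- F x) * g x" for x
      using e2ennreal_mult_nonneg[OF exp_ereal_nonneg, of "F x"]
        e2ennreal_mult_nonneg[OF exp_ereal_nonneg, of "- F x"]
      by (simp_all add: g_def)
    have "p < \<infinity> \<or> n < \<infinity>"
      using F pos neg by (auto simp: has_average_def)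
    \<comment> \<open>In \<open>ereal\<close> the difference of two infinities is again infinite, so
      a finite singular average forces both of its parts to be finite.\<close>
    moreover have "pS < \<infinity>" "nS < \<infinity>"
      using fin unfolding average_def pS_def[symmetric] nS_def[symmetric]
      by (cases pS; cases nS; simp)+
    \<comment> \<open>The finite terms \<open>pS\<close> and \<open>nS\<close> cancel; at most one
      of \<open>p\<close> and \<open>n\<close> is infinite, and then both sides are the same
      infinity.\<close>
    ultimately have "enn2ereal p - enn2ereal n
        = (enn2ereal (p + pS) - enn2ereal (n + nS)) - (enn2ereal pS - enn2ereal nS)"
      by (cases p; cases n; cases pS; cases nS) (auto simp: plus_ennreal.rep_eq)
    with \<open>p < \<infinity> \<or> n < \<infinity>\<close> show ?thesis
      unfolding has_average_def average_def prod pos neg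
      by (simp add: p_def n_def pS_def nS_def)
  qed

  define c where "c = 1 - lambda_S"
  have int_g: "(\<integral>\<^sup>+ x. g x \<partial>M) = ennreal c" and "0 \<le> c"
  proof -
    have *: "1 = (\<integral>\<^sup>+ x. g x \<partial>M) + emeasure Mr_S (space Mr_S)"
      using Mr_split[of "\<lambda>_. 1"] Mr.emeasure_space_1 by simp
    \<comment> \<open>\<open>measure\<close> returns 0 on sets of infinite mass, so finiteness has
      to come first for \<open>lambda_S\<close> to be the true singular mass.\<close>
    then have "emeasure Mr_S (space Mr_S) \<noteq> \<infinity>"
      by (auto simp: infinity_ennreal_def)
    then have "emeasure Mr_S (space Mr_S) = ennreal lambda_S" and "0 \<le> lambda_S"
      using assms(7) by (auto simp: emeasure_eq_ennreal_measure)
    with * obtain r where "(\<integral>\<^sup>+ x. g x \<partial>M) = ennreal r" "0 \<le> r" "1 = ennreal r + ennreal lambda_S"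
      by (cases "\<integral>\<^sup>+ x. g x \<partial>M") auto
    moreover from this \<open>0 \<le> lambda_S\<close> have "r = c"
      by (simp add: c_def flip: ennreal_plus ennreal_1)
    ultimately show "(\<integral>\<^sup>+ x. g x \<partial>M) = ennreal c" "0 \<le> c" by auto
  qed
  have "average M (\<lambda>x. exp_ereal (- \<sigma> x)) = ereal c"
    using int_g \<open>0 \<le> c\<close> exp_ereal_nonneg
    by (simp add: average_def g_def e2ennreal_neg zero_ennreal.rep_eq)

  define P where "P = (\<integral>\<^sup>+ x. e2ennreal (\<sigma> x) \<partial>M)"
  define N where "N = (\<integral>\<^sup>+ x. e2ennreal (- \<sigma> x) \<partial>M)"
  have "N \<le> ennreal c"
    unfolding N_def int_g[symmetric] g_def by (intro nn_integral_mono e2ennreal_le_exp_ereal)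
  then have N: "N < \<infinity>"
    using le_less_trans by fastforce
  then have has_avg: "has_average M \<sigma>"
    by (simp add: has_average_def N_def)

  have "average M \<sigma> \<ge> - ln_ereal (ereal c)"
  proof (cases "P = \<infinity>")
    case True
    with N have "average M \<sigma> = \<infinity>"
      by (cases N) (auto simp: average_def P_def N_def)
    then show ?thesis by simp
  next
    case False
    \<comment> \<open>Both parts of \<sigma> now have finite integral, so \<sigma> is finite almost
      everywhere and may be replaced by a real function, to which Jensen's inequality for the
      Bochner integral applies.\<close>
    define s where "s x = real_of_ereal (\<sigma> x)" for x
    have "AE x in M. e2ennreal (\<sigma> x) \<noteq> \<infinity>" "AE x in M. e2ennreal (- \<sigma> x) \<noteq> \<infinity>"
      using False N by (intro nn_integral_PInf_AE; simp add: P_def N_def less_top)+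
    then have s: "AE x in M. \<sigma> x = ereal (s x)"
    proof eventually_elim
      case (elim x)
      then show ?case by (cases "\<sigma> x") (auto simp: s_def)
    qed
    have [measurable]: "s \<in> borel_measurable M"
      unfolding s_def by measurable
    have P_s: "(\<integral>\<^sup>+ x. ennreal (s x) \<partial>M) = P" and N_s: "(\<integral>\<^sup>+ x. ennreal (- s x) \<partial>M) = N"
      unfolding P_def N_def using s by (auto intro!: nn_integral_cong_AE)
    have int_s: "integrable M s"
      using False N by (simp add: real_integrable_def P_s N_s)
    have "average M \<sigma> = average M (\<lambda>x. ereal (s x))"
      by (simp add: average_def P_s N_s P_def N_def)
    then have avg: "average M \<sigma> = ereal (M.expectation s)"
      by (simp add: average_eq_lebesgue_integral(2)[OF int_s])
    have "(\<integral>\<^sup>+ x. ennreal (exp (- s x)) \<partial>M) = (\<integral>\<^sup>+ x. g x \<partial>M)"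
      using s by (intro nn_integral_cong_AE) (auto simp: g_def exp_ereal_def)
    then have exp_s: "(\<integral>\<^sup>+ x. ennreal (exp (- s x)) \<partial>M) = ennreal c"
      by (simp add: int_g)
    \<comment> \<open>Jensen for the convex function \<open>exp\<close> on the whole line, applied
      to \<open>- s\<close>; \<open>exp_s\<close> supplies the integrability of the
      exponential.\<close>
    have "exp (M.expectation (\<lambda>x. - s x)) \<le> M.expectation (\<lambda>x. exp (- s x))"
      using int_s exp_s
      by (intro M.jensens_inequality[where I = UNIV] exp_convex)
         (auto intro!: integrableI_nonneg)
    also have "\<dots> = c"
      by (simp add: integral_eq_nn_integral exp_s \<open>0 \<le> c\<close>)
    finally have le: "exp (- M.expectation s) \<le> c"
      by simp
    \<comment> \<open>Positivity puts \<open>ln_ereal\<close> in its real branch, where the bound is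
      the logarithm of \<open>le\<close>.\<close>
    then have "0 < c"
      using exp_gt_zero less_le_trans by blast
    with le have "- M.expectation s \<le> ln c"
      by (simp add: ln_ge_iff)
    then have "- ln c \<le> M.expectation s"
      by linarith
    with \<open>0 < c\<close> show ?thesis
      by (simp add: avg ln_ereal_def)
  qed
  with has_avg \<open>average M (\<lambda>x. exp_ereal (- \<sigma> x)) = ereal c\<close>
  show ?thesis
    unfolding c_def by (intro conjI allI impI functional[THEN conjunct1] functional[THEN conjunct2]) simp_all
qed

end
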